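(* Let $E$ be a quasi-Banach ideal space with the Fatou property over $(T,\Sigma,\mu)$ and let $\varphi$ be an Orlicz function. If $\alpha^E_\varphi>0$, then the functional $\rho^E_\varphi:L^0\to[0,\infty]$ is a quasi-modular on $L^0$.
   Context: $(T,\Sigma,\mu)$ is a complete $\sigma$-finite measure space with $\mu(T)>0$; $L^0$ is the space of ($\mu$-a.e. classes of) real $\Sigma$-measurable functions on $T$, with the a.e. order; $L_\infty=L_\infty(T,\Sigma,\mu)$. A quasi-norm is a functional satisfying the axioms of a norm with the triangle inequality replaced by $\|x+y\|\le C(\|x\|+\|y\|)$ for some constant $C\ge1$. A quasi-Banach ideal space is a linear subspace $E\subset L^0$ with a complete quasi-norm $\|\cdot\|_E$ such that (i) $x\in L^0$, $y\in E$, $|x|\le|y|$ a.e. imply $x\in E$, $\|x\|_E\le\|y\|_E$; (ii) some $x\in E$ is strictly positive on $T$. $E$ has the Fatou property if $0\le x_n\uparrow|x|$ a.e., $x_n\in E$, $x\in L^0$, $\sup_n\|x_n\|_E<\infty$ imply $x\in E$ and $\|x_n\|_E\to\|x\|_E$. An Orlicz function is a non-decreasing $\varphi:[0,\infty)\to[0,\infty]$ with $\varphi(0)=0$, right continuous at $0$, continuous on $(0,b_\varphi)$ and left continuous at $b_\varphi$, where $b_\varphi=\sup\{u\ge0:\varphi(u)<\infty\}$, and with $\lim_{u\to\infty}\varphi(u)=\infty$. Lower Matuszewska–Orlicz indices: $\alpha^a_\varphi$ is the supremum of $p\in\mathbb R$ for which there is $K\ge1$ with $\varphi(au)\le Ka^p\varphi(u)$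 for all $u\ge0$, $0<a\le1$; $\alpha^\infty_\varphi$ is the supremum of $p\in\mathbb R$ for which there are $K\ge1$, $u_0>0$ with $\varphi(u_0)<\infty$ and this inequality for all $u\ge u_0$, $0<a\le1$; $\alpha^0_\varphi$ is the supremum of $p\in\mathbb R$ for which there are $K\ge1$, $u_0>0$ with this inequality for all $0\le u\le u_0$, $0<a\le1$. Put $\alpha^E_\varphi=\alpha^a_\varphi$ if neither $L_\infty\subset E$ nor $E\subset L_\infty$; $\alpha^E_\varphi=\alpha^\infty_\varphi$ if $L_\infty\subset E$; $\alpha^E_\varphi=\alpha^0_\varphi$ if $E\subset L_\infty$ (if $E=L_\infty$ as sets, the last two clauses overlap and either may be used). $\rho^E_\varphi(x)=\|\varphi(|x|)\|_E$ if $\varphi(|x|)\in E$, and $\rho^E_\varphi(x)=\infty$ otherwise. A function $\rho:X\to[0,\infty]$ on a real linear space $X$ is a quasi-modular if for all $x,y\in X$: (i) $\rho(0)=0$, and $\rho(\lambda x)\le 1$ for all $\lambda>0$ implies $x=0$; (ii) $\rho(-x)=\rho(x)$; (iii) $\lambda\mapsto\rho(\lambda x)$ is non-decreasing on $[0,\infty)$; (iv) there is a constant $M\ge 1$ with $\rho(\alpha x+\beta y)\le M[\rho(x)+\rho(y)]$ whenever $\alpha,\beta\ge 0$, $\alpha+\beta=1$; (v) there is $p>0$ such that for all $\varepsilon>0$, $A>0$ there exists $K=K(\varepsilon,A)\ge 1$ such that $\rho(ax)\le Ka^p\rho(x)+\varepsilon$ for any $0<a\le 1$ and any $x$ with $\rho(x)\le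 A$ (the constants $M,p,K$ not depending on $x,y$). *)

theory Defs
  imports "HOL-Analysis.Analysis" "HOL-Library.Function_Algebras"
begin

text \<open>Real-valued functions form a real vector space under the pointwise operations.\<close>

instantiation "fun" :: (type, real_vector) real_vector
begin

definition scaleR_fun :: "real \<Rightarrow> ('a \<Rightarrow> 'b) \<Rightarrow> 'a \<Rightarrow> 'b" where
  "scaleR_fun c f = (\<lambda>t. c *\<^sub>R f t)"

instance
  by standard (simp_all add: scaleR_fun_def fun_eq_iff algebra_simps)

end

text \<open>
  A real linear space is presented as a quotient \<open>X / Z\<close> of linear subspaces
  \<open>Z \<subseteq> X\<close> of a real vector space: its elements are given by representatives in \<open>X\<close>, and
  \<open>x\<close>, \<open>y\<close> represent the same element iff \<open>x - y \<in> Z\<close>. A functional on \<open>X / Z\<close> is a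
  function on \<open>X\<close> that does not depend on the representative. (With \<open>Z = {0}\<close> this is just
  a subspace \<open>X\<close>.)
\<close>

definition linear_space :: "'v::real_vector set \<Rightarrow> 'v set \<Rightarrow> bool" where
  "linear_space X Z \<longleftrightarrow> subspace X \<and> subspace Z \<and> Z \<subseteq> X"

definition functional_on :: "'v::real_vector set \<Rightarrow> 'v set \<Rightarrow> ('v \<Rightarrow> 'b) \<Rightarrow> bool" where
  "functional_on X Z f \<longleftrightarrow> (\<forall>x\<in>X. \<forall>y\<in>X. x - y \<in> Z \<longrightarrow> f x = f y)"

definition quasi_norm :: "'v::real_vector set \<Rightarrow> 'v set \<Rightarrow> ('v \<Rightarrow> real) \<Rightarrow> bool" where
  "quasi_norm X Z nrm \<longleftrightarrow>
     linear_space X Z \<and> functional_on X Z nrm \<and>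
     (\<forall>x\<in>X. 0 \<le> nrm x) \<and>
     (\<forall>x\<in>X. nrm x = 0 \<longleftrightarrow> x \<in> Z) \<and>
     (\<forall>x\<in>X. \<forall>c. nrm (c *\<^sub>R x) = \<bar>c\<bar> * nrm x) \<and>
     (\<exists>C\<ge>1. \<forall>x\<in>X. \<forall>y\<in>X. nrm (x + y) \<le> C * (nrm x + nrm y))"

definition complete_quasi_norm :: "'v::real_vector set \<Rightarrow> 'v set \<Rightarrow> ('v \<Rightarrow> real) \<Rightarrow> bool" where
  "complete_quasi_norm X Z nrm \<longleftrightarrow>
     quasi_norm X Z nrm \<and>
     (\<forall>s. (\<forall>n. s n \<in> X) \<and>
          (\<forall>e>0. \<exists>n0::nat. \<forall>m\<ge>n0. \<forall>n\<ge>n0. nrm (s m - s n) < e) \<longrightarrow>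
          (\<exists>x\<in>X. (\<lambda>n. nrm (s n - x)) \<longlonglongrightarrow> 0))"

definition quasi_modular :: "'v::real_vector set \<Rightarrow> 'v set \<Rightarrow> ('v \<Rightarrow> ennreal) \<Rightarrow> bool" where
  "quasi_modular X Z \<rho> \<longleftrightarrow>
     linear_space X Z \<and> functional_on X Z \<rho> \<and>
     \<rho> 0 = 0 \<and>
     (\<forall>x\<in>X. (\<forall>c>0. \<rho> (c *\<^sub>R x) \<le> 1) \<longrightarrow> x \<in> Z) \<and>
     (\<forall>x\<in>X. \<rho> (- x) = \<rho> x) \<and>
     (\<forall>x\<in>X. mono_on {0..} (\<lambda>c. \<rho> (c *\<^sub>R x))) \<and>
     (\<exists>M\<ge>1. \<forall>x\<in>X. \<forall>y\<in>X. \<forall>\<alpha>\<ge>0. \<forall>\<beta>\<ge>0. \<alpha> + \<beta> = 1 \<longrightarrow>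
        \<rho> (\<alpha> *\<^sub>R x + \<beta> *\<^sub>R y) \<le> ennreal M * (\<rho> x + \<rho> y)) \<and>
     (\<exists>p>0. \<forall>\<epsilon>>0. \<forall>A>0. \<exists>K\<ge>1. \<forall>a. 0 < a \<and> a \<le> 1 \<longrightarrow>
        (\<forall>x\<in>X. \<rho> x \<le> ennreal A \<longrightarrow>
           \<rho> (a *\<^sub>R x) \<le> ennreal (K * a powr p) * \<rho> x + ennreal \<epsilon>))"

text \<open>
  The space \<open>L\<^sup>0\<close> of measurable functions modulo equality almost everywhere is
  \<open>L0 M / null_functions M\<close>; its subspaces are likewise given by sets of representatives.
\<close>

definition L0 :: "'a measure \<Rightarrow> ('a \<Rightarrow> real) set" where
  "L0 M = borel_measurable M"

definition null_functions :: "'a measure \<Rightarrow> ('a \<Rightarrow> real) set" where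
  "null_functions M = {x \<in> L0 M. AE t in M. x t = 0}"

definition L_infinity :: "'a measure \<Rightarrow> ('a \<Rightarrow> real) set" where
  "L_infinity M = {x \<in> L0 M. \<exists>c. AE t in M. \<bar>x t\<bar> \<le> c}"

definition quasi_banach_ideal_space ::
    "'a measure \<Rightarrow> ('a \<Rightarrow> real) set \<Rightarrow> (('a \<Rightarrow> real) \<Rightarrow> real) \<Rightarrow> bool" where
  "quasi_banach_ideal_space M E nrm \<longleftrightarrow>
     E \<subseteq> L0 M \<and>
     complete_quasi_norm E (null_functions M) nrm \<and>
     (\<forall>x\<in>L0 M. \<forall>y\<in>E. (AE t in M. \<bar>x t\<bar> \<le> \<bar>y t\<bar>) \<longrightarrow> x \<in> E \<and> nrm x \<le> nrm y) \<and>
     (\<exists>x\<in>E. AE t in M. 0 < x t)"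

definition fatou_property ::
    "'a measure \<Rightarrow> ('a \<Rightarrow> real) set \<Rightarrow> (('a \<Rightarrow> real) \<Rightarrow> real) \<Rightarrow> bool" where
  "fatou_property M E nrm \<longleftrightarrow>
     (\<forall>s. \<forall>x\<in>L0 M.
        (\<forall>n::nat. s n \<in> E) \<and>
        (AE t in M. (\<forall>n. 0 \<le> s n t) \<and> incseq (\<lambda>n. s n t) \<and> (\<lambda>n. s n t) \<longlonglongrightarrow> \<bar>x t\<bar>) \<and>
        bdd_above (range (\<lambda>n. nrm (s n))) \<longrightarrow>
        x \<in> E \<and> (\<lambda>n. nrm (s n)) \<longlonglongrightarrow> nrm x)"

text \<open>
  A function \<open>[0, \<infinity>) \<rightarrow> [0, \<infinity>]\<close> is rendered as \<open>\<phi> :: real \<Rightarrow> ennreal\<close>; its values at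
  negative arguments are never used.
\<close>

definition orlicz_bound :: "(real \<Rightarrow> ennreal) \<Rightarrow> ereal" where
  "orlicz_bound \<phi> = Sup (ereal ` {u. 0 \<le> u \<and> \<phi> u < \<infinity>})"

definition orlicz_function :: "(real \<Rightarrow> ennreal) \<Rightarrow> bool" where
  "orlicz_function \<phi> \<longleftrightarrow>
     mono_on {0..} \<phi> \<and> \<phi> 0 = 0 \<and>
     continuous (at_right 0) \<phi> \<and>
     (\<forall>u>0. ereal u < orlicz_bound \<phi> \<longrightarrow> isCont \<phi> u) \<and>
     (\<forall>u>0. ereal u = orlicz_bound \<phi> \<longrightarrow> continuous (at_left u) \<phi>) \<and>
     (\<phi> \<longlongrightarrow> \<infinity>) at_top"

text \<open>The index inequality for the exponent \<open>p\<close>, with \<open>u\<close> ranging over \<open>U\<close>.\<close>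

definition index_ineq :: "(real \<Rightarrow> ennreal) \<Rightarrow> real set \<Rightarrow> real \<Rightarrow> real \<Rightarrow> bool" where
  "index_ineq \<phi> U K p \<longleftrightarrow>
     (\<forall>u\<in>U. \<forall>a. 0 < a \<and> a \<le> 1 \<longrightarrow> \<phi> (a * u) \<le> ennreal (K * a powr p) * \<phi> u)"

definition lower_index_all :: "(real \<Rightarrow> ennreal) \<Rightarrow> ereal" where
  "lower_index_all \<phi> = Sup (ereal ` {p. \<exists>K\<ge>1. index_ineq \<phi> {0..} K p})"

definition lower_index_infinity :: "(real \<Rightarrow> ennreal) \<Rightarrow> ereal" where
  "lower_index_infinity \<phi> =
     Sup (ereal ` {p. \<exists>K\<ge>1. \<exists>u0>0. \<phi> u0 < \<infinity> \<and> index_ineq \<phi> {u0..} K p})"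

definition lower_index_zero :: "(real \<Rightarrow> ennreal) \<Rightarrow> ereal" where
  "lower_index_zero \<phi> = Sup (ereal ` {p. \<exists>K\<ge>1. \<exists>u0>0. index_ineq \<phi> {0..u0} K p})"

text \<open>
  \<open>\<alpha>\<close> is a value of the lower index of \<open>\<phi>\<close> relative to \<open>E\<close>. This is a relation because
  for \<open>E = L\<^sub>\<infinity>\<close> the last two clauses overlap, and both values are then admitted.
\<close>

definition is_lower_index ::
    "'a measure \<Rightarrow> ('a \<Rightarrow> real) set \<Rightarrow> (real \<Rightarrow> ennreal) \<Rightarrow> ereal \<Rightarrow> bool" where
  "is_lower_index M E \<phi> \<alpha> \<longleftrightarrow>
     (\<not> L_infinity M \<subseteq> E \<and> \<not> E \<subseteq> L_infinity M \<and> \<alpha> = lower_index_all \<phi>) \<or>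
     (L_infinity M \<subseteq> E \<and> \<alpha> = lower_index_infinity \<phi>) \<or>
     (E \<subseteq> L_infinity M \<and> \<alpha> = lower_index_zero \<phi>)"

text \<open>
  The \<open>[0, \<infinity>]\<close>-valued function \<open>\<phi>(|x|)\<close> belongs to \<open>E \<subseteq> L\<^sup>0\<close> iff it is finite almost
  everywhere and its class, represented by the real-valued function below, lies in \<open>E\<close>.
\<close>

definition orlicz_comp :: "(real \<Rightarrow> ennreal) \<Rightarrow> ('a \<Rightarrow> real) \<Rightarrow> 'a \<Rightarrow> real" where
  "orlicz_comp \<phi> x = (\<lambda>t. enn2real (\<phi> \<bar>x t\<bar>))"

definition orlicz_modular ::
    "'a measure \<Rightarrow> ('a \<Rightarrow> real) set \<Rightarrow> (('a \<Rightarrow> real) \<Rightarrow> real) \<Rightarrow> (real \<Rightarrow> ennreal) \<Rightarrow>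
     ('a \<Rightarrow> real) \<Rightarrow> ennreal" where
  "orlicz_modular M E nrm \<phi> x =
     (if (AE t in M. \<phi> \<bar>x t\<bar> < \<infinity>) \<and> orlicz_comp \<phi> x \<in> E
      then ennreal (nrm (orlicz_comp \<phi> x)) else \<infinity>)"

end

theory Submission
  imports Defs
begin

text \<open>
  The quasi-norm of \<open>E\<close> extends to a functional \<open>N\<close> on \<open>[0, \<infinity>]\<close>-valued measurable functions,
  with value \<open>\<infinity>\<close> off \<open>E\<close>. It is monotone, positively homogeneous and quasi-subadditive, it
  vanishes only on null functions, and the modular is \<open>x \<mapsto> N (\<phi>(|x|))\<close>. So every axiom
  follows from a pointwise estimate for \<open>\<phi>\<close>, to which \<open>N\<close> is then applied.

  Separation of points: the indicator of \<open>{|x| \<ge> d}\<close> is at most \<open>\<phi>(c |x|) / r\<close> as soon as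
  \<open>\<phi>(c d) \<ge> r\<close>, so if all multiples of \<open>x\<close> have modular at most \<open>1\<close>, then its quasi-norm is at
  most \<open>1 / r\<close> for every \<open>r > 0\<close>. Convex combinations:
  \<open>|\<alpha> x + \<beta> y|\<close> is at most \<open>max |x| |y|\<close>, hence \<open>\<phi>(|\<alpha> x + \<beta> y|) \<le> \<phi>(|x|) + \<phi>(|y|)\<close>, and
  the constant is the one in the quasi-triangle inequality.

  The growth axiom is where the index enters. A positive index gives
  \<open>\<phi>(a u) \<le> K a\<^sup>p \<phi>(u)\<close> with some \<open>p > 0\<close>, for \<open>u\<close> in a range that depends on \<open>E\<close>, and it must
  be shown that the values of \<open>|x|\<close> outside this range do no harm.

  \<^item> If the range is \<open>[0, \<infinity>)\<close>, there is nothing to add.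
  \<^item> If the range is \<open>[u\<^sub>0, \<infinity>)\<close>, smaller \<open>u\<close> cost an arbitrarily small additive constant
    (\<open>index_ineq_at_top_perturbed\<close>). Constants lie in \<open>E\<close>, because \<open>L\<^sub>\<infinity> \<subseteq> E\<close>, so this is
    absorbed by \<open>\<epsilon>\<close>.
  \<^item> If the range is \<open>[0, u\<^sub>0]\<close>, then \<open>E \<subseteq> L\<^sub>\<infinity>\<close>, and this inclusion is automatically bounded
    (\<open>bounded_embedding\<close>, from completeness of \<open>E\<close>). A bound \<open>A\<close> on the modular therefore bounds
    \<open>\<phi>(|x|)\<close>, and then \<open>|x|\<close> because \<open>\<phi>\<close> tends to \<open>\<infinity>\<close>, by a constant \<open>u\<^sub>1\<close> that depends on \<open>A\<close>
    but not on \<open>x\<close>; and a larger bounded range only changes \<open>K\<close> (\<open>index_ineq_enlarge\<close>).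
\<close>

section \<open>Growth estimates for the generating function\<close>

lemma Sup_ereal_pos_obtains:
  assumes "Sup (ereal ` S) > 0"
  obtains p where "p \<in> S" "p > 0"
  using assms by (auto simp: less_Sup_iff)

text \<open>
  For \<open>u\<close> in \<open>[u\<^sub>0, u\<^sub>1]\<close>, replacing \<open>u\<close> by \<open>u\<^sub>0\<close> costs at most a factor \<open>u\<^sub>1 / u\<^sub>0\<close> in the
  dilation: if \<open>a u \<le> u\<^sub>0\<close>, then \<open>a u = b u\<^sub>0\<close> with \<open>b \<le> a u\<^sub>1 / u\<^sub>0\<close>, and otherwise
  \<open>a u\<^sub>1 / u\<^sub>0 > 1\<close>, so that monotonicity of \<open>\<phi>\<close> is enough.
\<close>

lemma index_ineq_enlarge:
  assumes mono: "mono_on {0..} \<phi>" and ii: "index_ineq \<phi> {0..u0} K p"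
    and K: "K \<ge> 1" and p: "p > 0" and u0: "u0 > 0" and u1: "u1 \<ge> u0"
  shows "index_ineq \<phi> {0..u1} (K * (u1 / u0) powr p) p"
  unfolding index_ineq_def
proof (intro ballI allI impI)
  fix u a :: real assume u: "u \<in> {0..u1}" and a: "0 < a \<and> a \<le> 1"
  have q1: "(u1 / u0) powr p \<ge> 1"
    using u0 u1 p by (intro ge_one_powr_ge_zero) auto
  show "\<phi> (a * u) \<le> ennreal (K * (u1 / u0) powr p * a powr p) * \<phi> u"
  proof (cases "u \<le> u0")
    case True
    then have "\<phi> (a * u) \<le> ennreal (K * a powr p) * \<phi> u"
      using ii u a by (auto simp: index_ineq_def)
    also have "\<dots> \<le> ennreal (K * (u1 / u0) powr p * a powr p) * \<phi> u"
    proof -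
      have "K * 1 \<le> K * (u1 / u0) powr p"
        using q1 K by (intro mult_left_mono) auto
      then have "K * a powr p \<le> K * (u1 / u0) powr p * a powr p"
        by (intro mult_right_mono) auto
      then show ?thesis by (rule mult_right_mono[OF ennreal_leI]) simp
    qed
    finally show ?thesis .
  next
    case False
    then have u': "u > u0" "u \<le> u1" using u by auto
    show ?thesis
    proof (cases "a * u \<le> u0")
      case True
      define b where "b = a * u / u0"
      have b: "0 < b" "b \<le> 1" using True a u' u0 by (auto simp: b_def)
      have "b \<le> a * (u1 / u0)"
        using a u' u0 by (simp add: b_def divide_right_mono)
      then have bp: "b powr p \<le> (u1 / u0) powr p * a powr p"
        using b p u0 u1 a by (subst mult.commute, subst powr_mult[symmetric]) (auto intro: powr_mono2)
      have "\<phi> (a * u) = \<phi> (b * u0)" using u0 by (simp add: b_def)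
      also have "\<dots> \<le> ennreal (K * b powr p) * \<phi> u0"
        using ii b u0 by (auto simp: index_ineq_def)
      also have "\<dots> \<le> ennreal (K * (u1 / u0) powr p * a powr p) * \<phi> u"
      proof -
        have "K * b powr p \<le> K * (u1 / u0) powr p * a powr p"
          using mult_left_mono[OF bp, of K] K by (simp add: mult.assoc)
        moreover have "\<phi> u0 \<le> \<phi> u" using mono_onD[OF mono, of u0 u] u' u0 by auto
        ultimately show ?thesis by (intro mult_mono[OF ennreal_leI]) auto
      qed
      finally show ?thesis .
    next
      case False
      have "u0 < a * u1"
        using False a u' mult_left_mono[of u u1 a] by linarith
      then have "1 \<le> u1 / u0 * a" using u0 by (simp add: field_simps)
      then have "1 \<le> (u1 / u0 * a) powr p" using p by (intro ge_one_powr_ge_zero) auto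
      then have "1 \<le> (u1 / u0) powr p * a powr p"
        using a u0 u1 by (simp add: powr_mult del: times_divide_eq_left)
      then have one: "1 \<le> K * (u1 / u0) powr p * a powr p"
        using K mult_mono[of 1 K 1 "(u1 / u0) powr p * a powr p"] by (simp add: mult.assoc)
      have "\<phi> (a * u) \<le> \<phi> u"
        using a u' u0 by (intro mono_onD[OF mono]) (auto intro: mult_left_le_one_le)
      also have "\<dots> \<le> ennreal (K * (u1 / u0) powr p * a powr p) * \<phi> u"
        using mult_right_mono[OF ennreal_leI[OF one], of "\<phi> u"] by simp
      finally show ?thesis .
    qed
  qed
qed

text \<open>
  Below \<open>u\<^sub>0\<close>, either \<open>a\<^sup>p\<close> is so small that \<open>\<phi>(a u) \<le> K a\<^sup>p \<phi>(u\<^sub>0) \<le> e\<close>, or \<open>a\<^sup>p\<close> is bounded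
  away from \<open>0\<close> and \<open>\<phi>(a u) \<le> \<phi>(u) \<le> K' a\<^sup>p \<phi>(u)\<close> for a large \<open>K'\<close>.
\<close>

lemma index_ineq_at_top_perturbed:
  assumes mono: "mono_on {0..} \<phi>" and ii: "index_ineq \<phi> {u0..} K p"
    and K: "K \<ge> 1" and u0: "u0 > 0" and fin: "\<phi> u0 < \<infinity>" and e: "e > 0"
  shows "\<exists>K'\<ge>1. \<forall>u\<ge>0. \<forall>a. 0 < a \<and> a \<le> 1 \<longrightarrow>
           \<phi> (a * u) \<le> ennreal (K' * a powr p) * \<phi> u + ennreal e"
proof -
  define r where "r = enn2real (\<phi> u0)"
  have r: "\<phi> u0 = ennreal r" "r \<ge> 0" using fin by (auto simp: r_def)
  \<comment> \<open>The second term makes \<open>K' a\<^sup>p \<ge> 1\<close> as soon as \<open>K a\<^sup>p r > e\<close>.\<close>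
  define K' where "K' = max K (K * r / e)"
  have K': "K' \<ge> 1" "K' \<ge> K" "K' \<ge> K * r / e" using K by (auto simp: K'_def)
  have "\<phi> (a * u) \<le> ennreal (K' * a powr p) * \<phi> u + ennreal e"
    if u: "u \<ge> 0" and a: "0 < a" "a \<le> 1" for u a
  proof -
    consider "u \<ge> u0" | "u < u0" "K * a powr p * r \<le> e"
      | "u < u0" "K * a powr p * r > e" by linarith
    then show ?thesis
    proof cases
      case 1
      then have "\<phi> (a * u) \<le> ennreal (K * a powr p) * \<phi> u"
        using ii a by (auto simp: index_ineq_def)
      also have "\<dots> \<le> ennreal (K' * a powr p) * \<phi> u"
        using K'(2) by (intro mult_right_mono[OF ennreal_leI] mult_right_mono[of K K']) auto
      also have "\<dots> \<le> ennreal (K' * a powr p) * \<phi> u + ennreal e" by simp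
      finally show ?thesis .
    next
      case 2
      have "\<phi> (a * u) \<le> \<phi> (a * u0)"
        using 2 a u by (intro mono_onD[OF mono]) auto
      also have "\<dots> \<le> ennreal (K * a powr p) * \<phi> u0"
        using ii a by (auto simp: index_ineq_def)
      also have "\<dots> = ennreal (K * a powr p * r)"
        using r K by (simp add: ennreal_mult)
      also have "\<dots> \<le> ennreal e" using 2 by (intro ennreal_leI) simp
      also have "\<dots> \<le> ennreal (K' * a powr p) * \<phi> u + ennreal e" by simp
      finally show ?thesis .
    next
      case 3
      have "1 \<le> K * r / e * a powr p" using 3 e by (simp add: field_simps)
      also have "\<dots> \<le> K' * a powr p" using K'(3) by (intro mult_right_mono) auto
      finally have one: "1 \<le> K' * a powr p" .
      have "\<phi> (a * u) \<le> \<phi> u"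
        using a u by (intro mono_onD[OF mono]) (auto intro: mult_left_le_one_le)
      also have "\<dots> \<le> ennreal (K' * a powr p) * \<phi> u"
        using mult_right_mono[OF ennreal_leI[OF one], of "\<phi> u"] by simp
      also have "\<dots> \<le> ennreal (K' * a powr p) * \<phi> u + ennreal e" by simp
      finally show ?thesis .
    qed
  qed
  then show ?thesis using K'(1) by blast
qed

text \<open>Sublevel sets of a monotone function are intervals.\<close>

lemma orlicz_comp_ennreal_measurable:
  assumes mono: "mono_on {0..} \<phi>" and x: "x \<in> borel_measurable M"
  shows "(\<lambda>t. \<phi> \<bar>x t :: real\<bar> :: ennreal) \<in> borel_measurable M"
proof -
  \<comment> \<open>\<open>\<phi>\<close> is monotone on \<open>[0, \<infinity>)\<close> only, and arbitrary to the left of \<open>0\<close>.\<close>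
  have "mono (\<lambda>u. \<phi> (max 0 u))"
    by (intro monoI mono_onD[OF mono]) auto
  then have "is_interval {u. \<phi> (max 0 u) < y}" for y
    unfolding is_interval_1 by (auto intro: le_less_trans dest: monoD)
  then have "(\<lambda>u. \<phi> (max 0 u)) \<in> borel_measurable borel"
    by (intro borel_measurableI_less) (simp add: real_interval_borel_measurable)
  then have "(\<lambda>t. \<phi> (max 0 \<bar>x t\<bar>)) \<in> borel_measurable M"
    using x by measurable
  then show ?thesis by simp
qed

section \<open>Quasi-Banach ideal spaces\<close>

locale quasi_banach_ideal =
  fixes M :: "'a measure" and E :: "('a \<Rightarrow> real) set" and nrm :: "('a \<Rightarrow> real) \<Rightarrow> real"
  assumes ideal_space: "quasi_banach_ideal_space M E nrm"
begin

lemma quasi_norm: "quasi_norm E (null_functions M) nrm"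
  using ideal_space by (auto simp: quasi_banach_ideal_space_def complete_quasi_norm_def)

lemma subspace_E: "subspace E"
  using quasi_norm by (auto simp: quasi_norm_def linear_space_def)

lemma measurable_E: "x \<in> E \<Longrightarrow> x \<in> borel_measurable M"
  using ideal_space by (auto simp: quasi_banach_ideal_space_def L0_def)

lemma
  assumes "x \<in> borel_measurable M" "y \<in> E" "AE t in M. \<bar>x t\<bar> \<le> \<bar>y t\<bar>"
  shows ideal: "x \<in> E" and nrm_mono: "nrm x \<le> nrm y"
  using ideal_space assms by (auto simp: quasi_banach_ideal_space_def L0_def)

lemma nrm_nonneg: "x \<in> E \<Longrightarrow> 0 \<le> nrm x"
  using quasi_norm by (auto simp: quasi_norm_def)

lemma nrm_eq_0_iff: "x \<in> E \<Longrightarrow> nrm x = 0 \<longleftrightarrow> (AE t in M. x t = 0)"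
  using quasi_norm measurable_E by (auto simp: quasi_norm_def null_functions_def L0_def)

lemma nrm_scale: "x \<in> E \<Longrightarrow> nrm (\<lambda>t. c * x t) = \<bar>c\<bar> * nrm x"
  using quasi_norm by (auto simp: quasi_norm_def scaleR_fun_def)

lemma scale_E: "x \<in> E \<Longrightarrow> (\<lambda>t. c * x t) \<in> E"
  using subspace_mul[OF subspace_E, of x c] by (simp add: scaleR_fun_def)

lemma add_E: "x \<in> E \<Longrightarrow> y \<in> E \<Longrightarrow> (\<lambda>t. x t + y t) \<in> E"
  using subspace_add[OF subspace_E, of x y] by (simp add: plus_fun_def)

lemma zero_E: "(\<lambda>t. 0) \<in> E"
  using subspace_0[OF subspace_E] by (simp add: zero_fun_def)

text \<open>Any admissible constant of the quasi-triangle inequality, not only the least one.\<close>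

definition modulus_of_concavity :: "real \<Rightarrow> bool" where
  "modulus_of_concavity C \<longleftrightarrow>
     C \<ge> 1 \<and> (\<forall>x\<in>E. \<forall>y\<in>E. nrm (\<lambda>t. x t + y t) \<le> C * (nrm x + nrm y))"

lemma modulus_of_concavityD:
  assumes "modulus_of_concavity C"
  shows "C \<ge> 1" "\<And>x y. x \<in> E \<Longrightarrow> y \<in> E \<Longrightarrow> nrm (\<lambda>t. x t + y t) \<le> C * (nrm x + nrm y)"
  using assms by (auto simp: modulus_of_concavity_def)

lemma ex_modulus_of_concavity: "\<exists>C. modulus_of_concavity C"
  using quasi_norm by (auto simp: modulus_of_concavity_def quasi_norm_def plus_fun_def)

lemma complete:
  assumes "\<And>n. s n \<in> E" "\<And>e. e > 0 \<Longrightarrow> \<exists>n0::nat. \<forall>m\<ge>n0. \<forall>n\<ge>n0. nrm (s m - s n) < e"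
  obtains x where "x \<in> E" "(\<lambda>n. nrm (s n - x)) \<longlonglongrightarrow> 0"
  using ideal_space assms unfolding quasi_banach_ideal_space_def complete_quasi_norm_def by blast

text \<open>
  Splitting off one summand at a time multiplies the tail by \<open>C\<close> at each step, so geometric
  decay with a ratio below \<open>1 / C\<close> keeps such sums under control.
\<close>

lemma nrm_sum_le:
  assumes mod: "modulus_of_concavity C"
    and f: "\<And>k. f k \<in> E"
  shows "(\<lambda>t. \<Sum>k<n. f k t) \<in> E"
    and "nrm (\<lambda>t. \<Sum>k<n. f k t) \<le> (\<Sum>k<n. C ^ Suc k * nrm (f k))"
proof -
  note C = modulus_of_concavityD[OF mod]
  have "(\<lambda>t. \<Sum>k<n. f k t) \<in> E \<and> nrm (\<lambda>t. \<Sum>k<n. f k t) \<le> (\<Sum>k<n. C ^ Suc k * nrm (f k))"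
    using f
  proof (induction n arbitrary: f)
    case 0
    then show ?case using zero_E nrm_eq_0_iff[OF zero_E] by simp
  next
    case (Suc n)
    note IH = Suc.IH[of "\<lambda>k. f (Suc k)", OF Suc.prems]
    have "nrm (\<lambda>t. f 0 t + (\<Sum>k<n. f (Suc k) t)) \<le> C * (nrm (f 0) + nrm (\<lambda>t. \<Sum>k<n. f (Suc k) t))"
      using IH Suc.prems by (intro C) auto
    also have "\<dots> \<le> C * (nrm (f 0) + (\<Sum>k<n. C ^ Suc k * nrm (f (Suc k))))"
      using IH C by (intro mult_left_mono) auto
    finally show ?case
      using IH add_E[OF Suc.prems[of 0] IH[THEN conjunct1]]
      by (simp add: sum.lessThan_Suc_shift sum_distrib_left algebra_simps del: sum.lessThan_Suc)
  qed
  then show "(\<lambda>t. \<Sum>k<n. f k t) \<in> E" "nrm (\<lambda>t. \<Sum>k<n. f k t) \<le> (\<Sum>k<n. C ^ Suc k * nrm (f k))"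
    by auto
qed

text \<open>
  The majorant is the limit in \<open>E\<close> of the partial sums \<open>s n\<close> of the series of the \<open>|y k|\<close>; the
  ratio \<open>1 / (2 C)\<close> makes them Cauchy. The limit dominates each \<open>|y k|\<close>
  although the convergence is only in the quasi-norm: the positive part of \<open>|y k| - x\<close> is at most
  \<open>|s n - x|\<close> for all \<open>n > k\<close>, hence has quasi-norm \<open>0\<close>.
\<close>

lemma common_majorant:
  assumes mod: "modulus_of_concavity C"
    and y: "\<And>k. y k \<in> E" and small: "\<And>k. nrm (y k) \<le> 1 / (2 * C) ^ k"
  shows "\<exists>x\<in>E. \<forall>k. AE t in M. \<bar>y k t\<bar> \<le> x t"
proof -
  note C = modulus_of_concavityD[OF mod]
  have [measurable]: "y k \<in> borel_measurable M" for k using y by (rule measurable_E)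
  define z where "z k = (\<lambda>t. \<bar>y k t\<bar>)" for k
  have zE: "z k \<in> E" for k unfolding z_def by (rule ideal[OF _ y[of k]]) auto
  have zsmall: "nrm (z k) \<le> 1 / (2 * C) ^ k" for k
    using nrm_mono[of "z k" "y k"] y[of k] small[of k] by (auto simp: z_def)
  define s where "s n = (\<lambda>t. \<Sum>k<n. z k t)" for n
  have sE: "s n \<in> E" for n unfolding s_def by (rule nrm_sum_le(1)[OF mod zE])
  have tail: "nrm (s (m + j) - s m) \<le> 2 * C / 2 ^ m" for m j
  proof -
    have "s (m + j) - s m = (\<lambda>t. \<Sum>k<j. z (m + k) t)"
    proof -
      have "(\<Sum>k<m + j. z k t) = (\<Sum>k<m. z k t) + (\<Sum>k<j. z (m + k) t)" for t
        by (induction j) auto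
      then show ?thesis by (auto simp: s_def fun_eq_iff)
    qed
    moreover have "nrm (\<lambda>t. \<Sum>k<j. z (m + k) t) \<le> (\<Sum>k<j. C ^ Suc k * nrm (z (m + k)))"
      by (rule nrm_sum_le(2)[OF mod zE])
    ultimately have "nrm (s (m + j) - s m) \<le> (\<Sum>k<j. C ^ Suc k * nrm (z (m + k)))"
      by (simp only:)
    also have "\<dots> \<le> (\<Sum>k<j. C / 2 ^ m * (1 / 2) ^ k)"
    proof (rule sum_mono)
      fix k
      have "C ^ Suc k * nrm (z (m + k)) \<le> C ^ Suc k * (1 / (2 * C) ^ (m + k))"
        using C zsmall by (intro mult_left_mono) auto
      also have "\<dots> = C / 2 ^ m * (1 / 2) ^ k * (1 / C ^ m)"
        using C by (simp add: field_simps power_add power_mult_distrib)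
      also have "\<dots> \<le> C / 2 ^ m * (1 / 2) ^ k * 1"
        using C by (intro mult_left_mono) (auto simp: field_simps)
      finally show "C ^ Suc k * nrm (z (m + k)) \<le> C / 2 ^ m * (1 / 2) ^ k" by simp
    qed
    also have "\<dots> = C / 2 ^ m * (\<Sum>k<j. (1 / 2) ^ k)"
      by (rule sum_distrib_left[symmetric])
    also have "(\<Sum>k<j. (1 / 2) ^ k) = 2 - 2 * (1 / 2 :: real) ^ j"
      by (simp add: sum_gp_strict)
    also have "C / 2 ^ m * \<dots> \<le> C / 2 ^ m * 2" using C by (intro mult_left_mono) auto
    finally show ?thesis by (simp only: mult.commute times_divide_eq_left times_divide_eq_right)
  qed
  have swap: "nrm (s m - s n) = nrm (s n - s m)" for m n
  proof -
    have "s n - s m \<in> E" using subspace_diff[OF subspace_E] sE by blast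
    from nrm_scale[OF this, of "-1"] have "nrm (\<lambda>t. - (s n t - s m t)) = nrm (s n - s m)" by simp
    then show ?thesis by (simp add: fun_diff_def)
  qed
  have cauchy: "\<exists>n0. \<forall>m\<ge>n0. \<forall>n\<ge>n0. nrm (s m - s n) < e" if "e > 0" for e
  proof -
    have "(\<lambda>m. 2 * C / 2 ^ m) \<longlonglongrightarrow> 0"
      using LIMSEQ_divide_realpow_zero[of 2 "2 * C"] by simp
    then have "\<forall>\<^sub>F m in sequentially. 2 * C / 2 ^ m < e"
      using that by (auto dest: order_tendstoD)
    then obtain n0 where n0: "\<And>m. m \<ge> n0 \<Longrightarrow> 2 * C / 2 ^ m < e"
      by (auto simp: eventually_sequentially)
    have *: "nrm (s n - s m) < e" if "m \<ge> n0" "m \<le> n" for m n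
      using tail[of m "n - m"] n0[OF that(1)] that(2) by simp
    have "nrm (s m - s n) < e" if "m \<ge> n0" "n \<ge> n0" for m n
    proof (cases "m \<le> n")
      case True
      then show ?thesis using *[of m n] that swap[of m n] by simp
    next
      case False
      then show ?thesis using *[of n m] that by simp
    qed
    then show ?thesis by blast
  qed
  obtain x where x: "x \<in> E" "(\<lambda>n. nrm (s n - x)) \<longlonglongrightarrow> 0"
    by (rule complete[OF sE cauchy])
  have [measurable]: "x \<in> borel_measurable M" "\<And>n. s n \<in> borel_measurable M"
    using x(1) sE measurable_E by auto
  have "AE t in M. \<bar>y k t\<bar> \<le> x t" for k
  proof -
    define d where "d = (\<lambda>t. max 0 (\<bar>y k t\<bar> - x t))"
    have dom: "d \<in> E \<and> nrm d \<le> nrm (s n - x)" if "n > k" for n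
    proof -
      have below: "\<bar>y k t\<bar> \<le> s n t" for t
        using member_le_sum[of k "{..<n}" "\<lambda>k. z k t"] that by (auto simp: s_def z_def)
      have "\<bar>d t\<bar> \<le> \<bar>(s n - x) t\<bar>" for t
        using below[of t] by (simp add: d_def)
      moreover have "s n - x \<in> E" using subspace_diff[OF subspace_E] sE x(1) by blast
      moreover have "d \<in> borel_measurable M" unfolding d_def by measurable
      ultimately show ?thesis using ideal[of d "s n - x"] nrm_mono[of d "s n - x"] by auto
    qed
    have "nrm d \<le> 0"
      by (rule LIMSEQ_le_const[OF x(2)]) (use dom in \<open>auto intro!: exI[of _ "Suc k"]\<close>)
    moreover have dE: "d \<in> E" using dom[of "Suc k"] by auto
    ultimately have "AE t in M. d t = 0" using nrm_eq_0_iff[OF dE] nrm_nonneg[OF dE] by simp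
    then show ?thesis by eventually_elim (auto simp: d_def max_def split: if_splits)
  qed
  then show ?thesis using x(1) by blast
qed

text \<open>
  If the inclusion were unbounded, there would be \<open>z k\<close> with quasi-norm at most \<open>(2 C)\<^sup>-\<^sup>k\<close>
  but essential supremum above \<open>k + 1\<close>. A common majorant of them in \<open>E\<close> could not be
  essentially bounded.
\<close>

lemma bounded_embedding:
  assumes sub: "E \<subseteq> L_infinity M"
  shows "\<exists>D>0. \<forall>y\<in>E. AE t in M. \<bar>y t\<bar> \<le> D * nrm y"
proof (rule ccontr)
  assume neg: "\<not> ?thesis"
  obtain C where mod: "modulus_of_concavity C" using ex_modulus_of_concavity by blast
  note C = modulus_of_concavityD[OF mod]
  have "\<exists>z\<in>E. nrm z \<le> 1 / (2 * C) ^ k \<and> \<not> (AE t in M. \<bar>z t\<bar> \<le> real (Suc k))" for k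
  proof -
    define D where "D = real (Suc k) * (2 * C) ^ k"
    have D: "D > 0" using C by (simp add: D_def)
    obtain y where y: "y \<in> E" "\<not> (AE t in M. \<bar>y t\<bar> \<le> D * nrm y)" using neg D by blast
    have "nrm y \<noteq> 0"
    proof
      assume "nrm y = 0"
      then show False using nrm_eq_0_iff[OF y(1)] y(2) by simp
    qed
    then have n0: "nrm y > 0" using nrm_nonneg[OF y(1)] by simp
    define c where "c = 1 / ((2 * C) ^ k * nrm y)"
    have c: "c > 0" using n0 C by (simp add: c_def)
    have "nrm (\<lambda>t. c * y t) = 1 / (2 * C) ^ k"
      using nrm_scale[OF y(1), of c] c n0 by (simp add: c_def)
    moreover have "\<bar>c * y t\<bar> \<le> real (Suc k) \<longleftrightarrow> \<bar>y t\<bar> \<le> D * nrm y" for t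
    proof -
      have "\<bar>c * y t\<bar> = c * \<bar>y t\<bar>" using c by (simp add: abs_mult)
      moreover have "c * (D * nrm y) = real (Suc k)" using n0 C by (simp add: c_def D_def)
      ultimately show ?thesis using c by (metis mult_le_cancel_left_pos)
    qed
    ultimately show ?thesis using y scale_E[OF y(1), of c] by (intro bexI[of _ "\<lambda>t. c * y t"]) auto
  qed
  then obtain z where z: "\<And>k. z k \<in> E" "\<And>k. nrm (z k) \<le> 1 / (2 * C) ^ k"
      "\<And>k. \<not> (AE t in M. \<bar>z k t\<bar> \<le> real (Suc k))"
    by metis
  obtain x where x: "x \<in> E" "\<And>k. AE t in M. \<bar>z k t\<bar> \<le> x t"
    using common_majorant[OF mod z(1,2)] by blast
  obtain c where c: "AE t in M. \<bar>x t\<bar> \<le> c" using sub x(1) by (auto simp: L_infinity_def)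
  obtain k where k: "c \<le> real k" using real_arch_simple by blast
  have "AE t in M. \<bar>z k t\<bar> \<le> real (Suc k)"
    using x(2)[of k] c by eventually_elim (use k in auto)
  then show False using z(3) by blast
qed

section \<open>Extending the quasi-norm to functions with values in the extended half-line\<close>

text \<open>
  Working with \<open>[0, \<infinity>]\<close>-valued functions removes the case distinctions between \<open>\<phi>(|x|) \<in> E\<close>,
  \<open>\<phi>(|x|) \<notin> E\<close> and \<open>\<phi>(|x|) = \<infinity>\<close> on a set of positive measure from all later estimates.
\<close>

definition ext_norm :: "('a \<Rightarrow> ennreal) \<Rightarrow> ennreal" where
  "ext_norm f =
     (if (AE t in M. f t < \<infinity>) \<and> (\<lambda>t. enn2real (f t)) \<in> E
      then ennreal (nrm (\<lambda>t. enn2real (f t))) else \<infinity>)"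

lemma orlicz_modular_eq_ext_norm: "orlicz_modular M E nrm \<phi> x = ext_norm (\<lambda>t. \<phi> \<bar>x t\<bar>)"
  by (simp add: orlicz_modular_def ext_norm_def orlicz_comp_def)

lemma ext_norm_mono:
  assumes [measurable]: "f \<in> borel_measurable M" and le: "AE t in M. f t \<le> g t"
  shows "ext_norm f \<le> ext_norm g"
proof (cases "(AE t in M. g t < \<infinity>) \<and> (\<lambda>t. enn2real (g t)) \<in> E")
  case True
  then have fin: "AE t in M. g t < \<infinity>" and gE: "(\<lambda>t. enn2real (g t)) \<in> E" by auto
  have f: "AE t in M. f t < \<infinity>" using fin le by eventually_elim auto
  have "AE t in M. \<bar>enn2real (f t)\<bar> \<le> \<bar>enn2real (g t)\<bar>"
    using fin le by eventually_elim (auto intro: enn2real_mono)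
  then show ?thesis
    using f True ideal[OF _ gE, of "\<lambda>t. enn2real (f t)"] nrm_mono[OF _ gE, of "\<lambda>t. enn2real (f t)"]
    by (auto simp: ext_norm_def intro: ennreal_leI)
qed (auto simp: ext_norm_def)

lemma ext_norm_cmult:
  assumes c: "c > 0"
  shows "ext_norm (\<lambda>t. ennreal c * f t) \<le> ennreal c * ext_norm f"
proof (cases "(AE t in M. f t < \<infinity>) \<and> (\<lambda>t. enn2real (f t)) \<in> E")
  case True
  then have fin: "AE t in M. f t < \<infinity>" and fE: "(\<lambda>t. enn2real (f t)) \<in> E" by auto
  have "AE t in M. ennreal c * f t < \<infinity>"
    using fin by eventually_elim (auto simp: ennreal_mult_less_top)
  moreover have "(\<lambda>t. enn2real (ennreal c * f t)) = (\<lambda>t. c * enn2real (f t))"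
    using c by (simp add: enn2real_mult)
  ultimately show ?thesis
    using True c scale_E[OF fE, of c] nrm_scale[OF fE, of c] nrm_nonneg[OF fE]
    by (simp add: ext_norm_def ennreal_mult)
next
  case False
  then show ?thesis using c by (auto simp: ext_norm_def ennreal_mult_top)
qed

lemma ext_norm_add:
  obtains C where "C \<ge> 1"
    "\<And>f g. f \<in> borel_measurable M \<Longrightarrow> g \<in> borel_measurable M \<Longrightarrow>
       ext_norm (\<lambda>t. f t + g t) \<le> ennreal C * (ext_norm f + ext_norm g)"
proof -
  obtain C where mod: "modulus_of_concavity C" using ex_modulus_of_concavity by blast
  note C = modulus_of_concavityD[OF mod]
  have "ext_norm (\<lambda>t. f t + g t) \<le> ennreal C * (ext_norm f + ext_norm g)"
    if [measurable]: "f \<in> borel_measurable M" "g \<in> borel_measurable M" for f g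
  proof (cases "((AE t in M. f t < \<infinity>) \<and> (\<lambda>t. enn2real (f t)) \<in> E) \<and>
      ((AE t in M. g t < \<infinity>) \<and> (\<lambda>t. enn2real (g t)) \<in> E)")
    case True
    define f' g' where "f' = (\<lambda>t. enn2real (f t))" and "g' = (\<lambda>t. enn2real (g t))"
    have E: "f' \<in> E" "g' \<in> E" and fin: "AE t in M. f t < \<infinity>" "AE t in M. g t < \<infinity>"
      using True by (auto simp: f'_def g'_def)
    have sum: "AE t in M. f t + g t = ennreal (f' t + g' t)"
      using fin by eventually_elim (auto simp: f'_def g'_def ennreal_plus)
    have "ext_norm (\<lambda>t. f t + g t) \<le> ext_norm (\<lambda>t. ennreal (f' t + g' t))"
      using sum by (intro ext_norm_mono) (auto elim: AE_mp)
    also have "\<dots> = ennreal (nrm (\<lambda>t. f' t + g' t))"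
      using add_E[OF E] by (simp add: ext_norm_def f'_def g'_def del: ennreal_plus)
    also have "\<dots> \<le> ennreal (C * (nrm f' + nrm g'))" using C(2)[OF E] by (rule ennreal_leI)
    also have "\<dots> = ennreal C * (ext_norm f + ext_norm g)"
      using True C(1) nrm_nonneg[OF E(1)] nrm_nonneg[OF E(2)]
      by (simp add: ext_norm_def f'_def g'_def ennreal_mult ennreal_plus)
    finally show ?thesis .
  next
    case False
    then have "ext_norm f + ext_norm g = \<infinity>" by (auto simp: ext_norm_def)
    then have "ennreal C * (ext_norm f + ext_norm g) = \<infinity>"
      using C(1) by (simp only: ennreal_mult_top infinity_ennreal_def) simp
    then show ?thesis by simp
  qed
  then show ?thesis using C(1) that by blast
qed

lemma ext_norm_eq_0_imp:
  assumes "ext_norm f = 0"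
  shows "AE t in M. f t = 0"
proof -
  have fin: "AE t in M. f t < \<infinity>" and fE: "(\<lambda>t. enn2real (f t)) \<in> E"
    and "nrm (\<lambda>t. enn2real (f t)) = 0"
    using assms nrm_nonneg by (auto simp: ext_norm_def split: if_splits)
  then have "AE t in M. enn2real (f t) = 0" using nrm_eq_0_iff[OF fE] by simp
  then show ?thesis using fin by eventually_elim (auto simp: enn2real_eq_0_iff)
qed

lemma ext_norm_bound_L_infinity:
  assumes "E \<subseteq> L_infinity M"
  obtains D where "D > 0" "\<And>f A. A > 0 \<Longrightarrow> ext_norm f \<le> ennreal A \<Longrightarrow> AE t in M. f t \<le> ennreal (D * A)"
proof -
  obtain D where D: "D > 0" "\<And>y. y \<in> E \<Longrightarrow> AE t in M. \<bar>y t\<bar> \<le> D * nrm y"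
    using bounded_embedding[OF assms] by blast
  have "AE t in M. f t \<le> ennreal (D * A)" if A: "A > 0" "ext_norm f \<le> ennreal A" for f A
  proof -
    have fin: "AE t in M. f t < \<infinity>" and fE: "(\<lambda>t. enn2real (f t)) \<in> E"
      and n: "nrm (\<lambda>t. enn2real (f t)) \<le> A"
      using A nrm_nonneg by (auto simp: ext_norm_def top_unique split: if_splits)
    have "D * nrm (\<lambda>t. enn2real (f t)) \<le> D * A" using n D(1) by simp
    from fin D(2)[OF fE] show ?thesis
    proof eventually_elim
      case (elim t)
      then have "ennreal (enn2real (f t)) \<le> ennreal (D * A)" using \<open>D * _ \<le> D * A\<close> by (intro ennreal_leI) linarith
      then show ?case using elim by simp
    qed
  qed
  then show ?thesis using D(1) that by blast
qed

section \<open>The growth axiom\<close>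

definition growth_axiom :: "(real \<Rightarrow> ennreal) \<Rightarrow> real \<Rightarrow> bool" where
  "growth_axiom \<phi> p \<longleftrightarrow>
     (\<forall>\<epsilon>>0. \<forall>A>0. \<exists>K\<ge>1. \<forall>a. 0 < a \<and> a \<le> 1 \<longrightarrow>
        (\<forall>x\<in>borel_measurable M. ext_norm (\<lambda>t. \<phi> \<bar>x t\<bar>) \<le> ennreal A \<longrightarrow>
           ext_norm (\<lambda>t. \<phi> \<bar>a * x t\<bar>) \<le>
             ennreal (K * a powr p) * ext_norm (\<lambda>t. \<phi> \<bar>x t\<bar>) + ennreal \<epsilon>))"

lemma ext_norm_dilation_le:
  assumes mono: "mono_on {0..} \<phi>" and ii: "index_ineq \<phi> U K p" and K: "K \<ge> 1"
    and a: "0 < a" "a \<le> 1" and x: "(x :: 'a \<Rightarrow> real) \<in> borel_measurable M" and U: "AE t in M. \<bar>x t\<bar> \<in> U"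
  shows "ext_norm (\<lambda>t. \<phi> \<bar>a * x t\<bar>) \<le> ennreal (K * a powr p) * ext_norm (\<lambda>t. \<phi> \<bar>x t\<bar>)"
proof -
  have "AE t in M. \<phi> \<bar>a * x t\<bar> \<le> ennreal (K * a powr p) * \<phi> \<bar>x t\<bar>"
    using U by eventually_elim (use ii a in \<open>auto simp: index_ineq_def abs_mult\<close>)
  then have "ext_norm (\<lambda>t. \<phi> \<bar>a * x t\<bar>) \<le> ext_norm (\<lambda>t. ennreal (K * a powr p) * \<phi> \<bar>x t\<bar>)"
    using x by (intro ext_norm_mono orlicz_comp_ennreal_measurable[OF mono]) auto
  also have "\<dots> \<le> ennreal (K * a powr p) * ext_norm (\<lambda>t. \<phi> \<bar>x t\<bar>)"
    using K a by (intro ext_norm_cmult) auto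
  finally show ?thesis .
qed

text \<open>
  The next three lemmas correspond to the three clauses in the choice of the index. The
  additive \<open>\<epsilon>\<close> pays for the small values of \<open>|x|\<close> when \<open>L\<^sub>\<infinity> \<subseteq> E\<close>, and the bound \<open>A\<close> excludes
  the large ones when \<open>E \<subseteq> L\<^sub>\<infinity>\<close>.
\<close>

lemma growth_axiom_all:
  assumes mono: "mono_on {0..} \<phi>" and pos: "lower_index_all \<phi> > 0"
  shows "\<exists>p>0. growth_axiom \<phi> p"
proof -
  obtain p K where p: "p > 0" and K: "K \<ge> 1" "index_ineq \<phi> {0..} K p"
    using Sup_ereal_pos_obtains[OF pos[unfolded lower_index_all_def]] by blast
  have "growth_axiom \<phi> p"
    unfolding growth_axiom_def
  proof (intro allI impI exI[of _ K] conjI ballI)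
    fix e A a :: real and x :: "'a \<Rightarrow> real" assume "0 < a \<and> a \<le> 1" "x \<in> borel_measurable M"
    then have "ext_norm (\<lambda>t. \<phi> \<bar>a * x t\<bar>) \<le> ennreal (K * a powr p) * ext_norm (\<lambda>t. \<phi> \<bar>x t\<bar>)"
      using K by (intro ext_norm_dilation_le[OF mono]) auto
    then show "ext_norm (\<lambda>t. \<phi> \<bar>a * x t\<bar>) \<le>
        ennreal (K * a powr p) * ext_norm (\<lambda>t. \<phi> \<bar>x t\<bar>) + ennreal e"
      by (rule order_trans) simp
  qed (rule K(1))
  then show ?thesis using p by blast
qed

lemma growth_axiom_infinity:
  assumes mono: "mono_on {0..} \<phi>" and pos: "lower_index_infinity \<phi> > 0"
    and sub: "L_infinity M \<subseteq> E"
  shows "\<exists>p>0. growth_axiom \<phi> p"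
proof -
  obtain p K u0 where p: "p > 0" and K: "K \<ge> 1" "u0 > 0" "\<phi> u0 < \<infinity>" "index_ineq \<phi> {u0..} K p"
    using Sup_ereal_pos_obtains[OF pos[unfolded lower_index_infinity_def]] by blast
  obtain C where C: "C \<ge> 1"
    "\<And>f g. f \<in> borel_measurable M \<Longrightarrow> g \<in> borel_measurable M \<Longrightarrow>
       ext_norm (\<lambda>t. f t + g t) \<le> ennreal C * (ext_norm f + ext_norm g)"
    by (rule ext_norm_add) blast
  have one: "(\<lambda>t. 1) \<in> E"
    by (rule subsetD[OF sub]) (auto simp: L_infinity_def L0_def)
  define N where "N = nrm (\<lambda>t. 1)"
  have N: "N \<ge> 0" using nrm_nonneg[OF one] by (simp add: N_def)
  have "growth_axiom \<phi> p"
    unfolding growth_axiom_def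
  proof (intro allI impI)
    fix e A :: real assume e: "e > 0"
    \<comment> \<open>The additive constant \<open>d\<close> contributes \<open>C d N\<close> to the quasi-norm, which has to be
       at most \<open>e\<close>; the \<open>+ 1\<close> keeps the denominator positive.\<close>
    define d where "d = e / (C * (N + 1))"
    have d: "d > 0" using e C N by (simp add: d_def)
    have CdN: "C * (d * N) \<le> e"
    proof -
      have "C * (d * N) = e * (N / (N + 1))" using C N by (simp add: d_def)
      also have "\<dots> \<le> e * 1" using e N by (intro mult_left_mono) auto
      finally show ?thesis by simp
    qed
    obtain K' where K': "K' \<ge> 1" "\<And>u a. u \<ge> 0 \<Longrightarrow> 0 < a \<and> a \<le> 1 \<Longrightarrow>
        \<phi> (a * u) \<le> ennreal (K' * a powr p) * \<phi> u + ennreal d"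
      using index_ineq_at_top_perturbed[OF mono K(4,1,2,3) d] by blast
    show "\<exists>K\<ge>1. \<forall>a. 0 < a \<and> a \<le> 1 \<longrightarrow>
        (\<forall>x\<in>borel_measurable M. ext_norm (\<lambda>t. \<phi> \<bar>x t\<bar>) \<le> ennreal A \<longrightarrow>
           ext_norm (\<lambda>t. \<phi> \<bar>a * x t\<bar>) \<le>
             ennreal (K * a powr p) * ext_norm (\<lambda>t. \<phi> \<bar>x t\<bar>) + ennreal e)"
    proof (intro exI[of _ "C * K'"] conjI allI impI ballI)
      show "C * K' \<ge> 1" using C(1) K'(1) mult_mono[of 1 C 1 K'] by simp
      fix a :: real and x :: "'a \<Rightarrow> real" assume a: "0 < a \<and> a \<le> 1" and x: "x \<in> borel_measurable M"
      have [measurable]: "(\<lambda>t. \<phi> \<bar>x t\<bar>) \<in> borel_measurable M"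
        by (rule orlicz_comp_ennreal_measurable[OF mono x])
      have "ext_norm (\<lambda>t. \<phi> \<bar>a * x t\<bar>) \<le>
          ext_norm (\<lambda>t. ennreal (K' * a powr p) * \<phi> \<bar>x t\<bar> + ennreal d * 1)"
        using K'(2)[of "\<bar>x _\<bar>" a] a x
        by (intro ext_norm_mono orlicz_comp_ennreal_measurable[OF mono]) (auto simp: abs_mult)
      also have "\<dots> \<le> ennreal C * (ext_norm (\<lambda>t. ennreal (K' * a powr p) * \<phi> \<bar>x t\<bar>)
          + ext_norm (\<lambda>t. ennreal d * 1))"
        by (intro C(2)) auto
      also have "\<dots> \<le> ennreal C * (ennreal (K' * a powr p) * ext_norm (\<lambda>t. \<phi> \<bar>x t\<bar>)
          + ennreal d * ext_norm (\<lambda>t. 1))"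
        using K'(1) a d by (intro mult_left_mono add_mono ext_norm_cmult) auto
      also have "ext_norm (\<lambda>t. 1) = ennreal N"
        using one by (simp add: ext_norm_def N_def)
      also have "ennreal C * (ennreal (K' * a powr p) * ext_norm (\<lambda>t. \<phi> \<bar>x t\<bar>) + ennreal d * ennreal N)
          = ennreal (C * K' * a powr p) * ext_norm (\<lambda>t. \<phi> \<bar>x t\<bar>) + ennreal (C * (d * N))"
        using C(1) K'(1) d N by (simp add: ennreal_mult distrib_left mult.assoc)
      also have "\<dots> \<le> ennreal (C * K' * a powr p) * ext_norm (\<lambda>t. \<phi> \<bar>x t\<bar>) + ennreal e"
        using CdN by (intro add_left_mono ennreal_leI)
      finally show "ext_norm (\<lambda>t. \<phi> \<bar>a * x t\<bar>) \<le>
          ennreal (C * K' * a powr p) * ext_norm (\<lambda>t. \<phi> \<bar>x t\<bar>) + ennreal e" .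
    qed
  qed
  then show ?thesis using p by blast
qed

lemma growth_axiom_zero:
  assumes mono: "mono_on {0..} \<phi>" and lim: "(\<phi> \<longlongrightarrow> \<infinity>) at_top"
    and pos: "lower_index_zero \<phi> > 0" and sub: "E \<subseteq> L_infinity M"
  shows "\<exists>p>0. growth_axiom \<phi> p"
proof -
  obtain p K u0 where p: "p > 0" and K: "K \<ge> 1" "u0 > 0" "index_ineq \<phi> {0..u0} K p"
    using Sup_ereal_pos_obtains[OF pos[unfolded lower_index_zero_def]] by blast
  obtain D where D: "D > 0"
    "\<And>f A. A > 0 \<Longrightarrow> ext_norm f \<le> ennreal A \<Longrightarrow> AE t in M. f t \<le> ennreal (D * A)"
    using ext_norm_bound_L_infinity[OF sub] by blast
  have "growth_axiom \<phi> p"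
    unfolding growth_axiom_def
  proof (intro allI impI)
    fix e A :: real assume A: "A > 0"
    have "\<forall>\<^sub>F u in at_top. ennreal (D * A) < \<phi> u"
      using order_tendstoD(1)[OF lim, of "ennreal (D * A)"] by simp
    then obtain v where v: "\<And>u. u \<ge> v \<Longrightarrow> ennreal (D * A) < \<phi> u"
      by (auto simp: eventually_at_top_linorder)
    define u1 where "u1 = max u0 v"
    define K' where "K' = K * (u1 / u0) powr p"
    have ii: "index_ineq \<phi> {0..u1} K' p"
      unfolding K'_def by (rule index_ineq_enlarge[OF mono K(3,1) p K(2)]) (simp add: u1_def)
    have "(u1 / u0) powr p \<ge> 1"
      using K(2) p by (intro ge_one_powr_ge_zero) (auto simp: u1_def)
    then have K': "K' \<ge> 1"
      using K(1) mult_mono[of 1 K 1 "(u1 / u0) powr p"] by (simp add: K'_def)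
    show "\<exists>K\<ge>1. \<forall>a. 0 < a \<and> a \<le> 1 \<longrightarrow>
        (\<forall>x\<in>borel_measurable M. ext_norm (\<lambda>t. \<phi> \<bar>x t\<bar>) \<le> ennreal A \<longrightarrow>
           ext_norm (\<lambda>t. \<phi> \<bar>a * x t\<bar>) \<le>
             ennreal (K * a powr p) * ext_norm (\<lambda>t. \<phi> \<bar>x t\<bar>) + ennreal e)"
    proof (intro exI[of _ K'] conjI allI impI ballI K')
      fix a :: real and x :: "'a \<Rightarrow> real" assume a: "0 < a \<and> a \<le> 1" and x: "x \<in> borel_measurable M"
        and le: "ext_norm (\<lambda>t. \<phi> \<bar>x t\<bar>) \<le> ennreal A"
      have "AE t in M. \<bar>x t\<bar> \<in> {0..u1}"
        using D(2)[OF A le]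
      proof eventually_elim
        case (elim t)
        then have "\<not> v \<le> \<bar>x t\<bar>" using v[of "\<bar>x t\<bar>"] by (auto simp: not_less)
        then show ?case by (auto simp: u1_def)
      qed
      then have "ext_norm (\<lambda>t. \<phi> \<bar>a * x t\<bar>) \<le> ennreal (K' * a powr p) * ext_norm (\<lambda>t. \<phi> \<bar>x t\<bar>)"
        using a by (intro ext_norm_dilation_le[OF mono ii K' _ _ x]) auto
      then show "ext_norm (\<lambda>t. \<phi> \<bar>a * x t\<bar>) \<le>
          ennreal (K' * a powr p) * ext_norm (\<lambda>t. \<phi> \<bar>x t\<bar>) + ennreal e"
        by (rule order_trans) simp
    qed
  qed
  then show ?thesis using p by blast
qed

section \<open>Separation and convex combinations\<close>

text \<open>
  Since \<open>\<phi>\<close> tends to \<open>\<infinity>\<close>, a large dilation makes \<open>\<phi>(c |x|)\<close> exceed any \<open>r\<close> on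
  \<open>{|x| \<ge> d}\<close>, while its quasi-norm stays at most \<open>1\<close>. So the indicator of this set has
  quasi-norm at most \<open>1 / r\<close> for every \<open>r\<close>, and the set is null.
\<close>

lemma modular_separates:
  assumes mono: "mono_on {0..} \<phi>" and lim: "(\<phi> \<longlongrightarrow> \<infinity>) at_top"
    and x: "(x :: 'a \<Rightarrow> real) \<in> borel_measurable M"
    and le: "\<And>c. c > 0 \<Longrightarrow> ext_norm (\<lambda>t. \<phi> \<bar>c * x t\<bar>) \<le> 1"
  shows "AE t in M. x t = 0"
proof -
  have [measurable]: "x \<in> borel_measurable M" by fact
  have below: "AE t in M. \<not> \<bar>x t\<bar> \<ge> d" if d: "d > 0" for d :: real
  proof -
    define ind :: "'a \<Rightarrow> ennreal" where "ind t = (if \<bar>x t\<bar> \<ge> d then 1 else 0)" for t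
    have [measurable]: "ind \<in> borel_measurable M" unfolding ind_def by measurable
    have bound: "ext_norm ind \<le> ennreal (1 / r)" if r: "r > 0" for r :: real
    proof -
      have "\<forall>\<^sub>F u in at_top. ennreal r < \<phi> u"
        using order_tendstoD(1)[OF lim, of "ennreal r"] by simp
      then obtain v where v: "\<And>u. u \<ge> v \<Longrightarrow> ennreal r < \<phi> u"
        by (auto simp: eventually_at_top_linorder)
      \<comment> \<open>\<open>c d \<ge> v\<close>, and the maximum with \<open>1\<close> keeps \<open>c\<close> positive.\<close>
      define c where "c = max 1 v / d"
      have c: "c > 0" using d by (simp add: c_def)
      have pt: "ind t \<le> ennreal (1 / r) * \<phi> \<bar>c * x t\<bar>" for t
      proof (cases "\<bar>x t\<bar> \<ge> d")
        case True
        have "v \<le> c * d" using d by (simp add: c_def)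
        also have "\<dots> \<le> \<bar>c * x t\<bar>" using True c by (simp add: abs_mult)
        finally have "ennreal r \<le> \<phi> \<bar>c * x t\<bar>" using v by (auto intro: less_imp_le)
        then have "ennreal (1 / r) * ennreal r \<le> ennreal (1 / r) * \<phi> \<bar>c * x t\<bar>"
          by (intro mult_left_mono) auto
        moreover have "ennreal (1 / r) * ennreal r = 1"
          using r ennreal_mult[of "1 / r" r] by simp
        ultimately show ?thesis using True by (simp only: ind_def if_True)
      qed (simp add: ind_def)
      have "ext_norm ind \<le> ext_norm (\<lambda>t. ennreal (1 / r) * \<phi> \<bar>c * x t\<bar>)"
        using pt by (intro ext_norm_mono) auto
      also have "\<dots> \<le> ennreal (1 / r) * ext_norm (\<lambda>t. \<phi> \<bar>c * x t\<bar>)"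
        using r by (intro ext_norm_cmult) auto
      also have "\<dots> \<le> ennreal (1 / r) * 1" using le[OF c] by (intro mult_left_mono) auto
      finally show ?thesis by simp
    qed
    have small: "ext_norm ind \<le> 0 + ennreal e" if "e > 0" for e :: real
      using bound[of "1 / e"] that by simp
    have "ext_norm ind \<le> 0" by (rule ennreal_le_epsilon) (rule small)
    then have "AE t in M. ind t = 0" by (intro ext_norm_eq_0_imp) simp
    then show ?thesis by eventually_elim (auto simp: ind_def split: if_splits)
  qed
  have "AE t in M. \<forall>n::nat. \<not> \<bar>x t\<bar> \<ge> inverse (real (Suc n))"
    using below by (simp add: AE_all_countable)
  then show ?thesis
  proof eventually_elim
    case (elim t)
    show ?case
    proof (rule ccontr)
      assume "x t \<noteq> 0"
      then obtain n where "inverse (real (Suc n)) < \<bar>x t\<bar>" using reals_Archimedean[of "\<bar>x t\<bar>"] by auto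
      then show False using elim less_imp_le by blast
    qed
  qed
qed

lemma modular_convex_combination:
  assumes mono: "mono_on {0..} \<phi>"
  shows "\<exists>C\<ge>1. \<forall>x\<in>borel_measurable M. \<forall>y\<in>borel_measurable M. \<forall>\<alpha>\<ge>0::real. \<forall>\<beta>\<ge>0. \<alpha> + \<beta> = 1 \<longrightarrow>
     ext_norm (\<lambda>t. \<phi> \<bar>\<alpha> * x t + \<beta> * y t\<bar>) \<le>
       ennreal C * (ext_norm (\<lambda>t. \<phi> \<bar>x t\<bar>) + ext_norm (\<lambda>t. \<phi> \<bar>y t\<bar>))"
proof -
  obtain C where C: "C \<ge> 1"
    "\<And>f g. f \<in> borel_measurable M \<Longrightarrow> g \<in> borel_measurable M \<Longrightarrow>
       ext_norm (\<lambda>t. f t + g t) \<le> ennreal C * (ext_norm f + ext_norm g)"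
    by (rule ext_norm_add) blast
  have "ext_norm (\<lambda>t. \<phi> \<bar>\<alpha> * x t + \<beta> * y t\<bar>) \<le>
       ennreal C * (ext_norm (\<lambda>t. \<phi> \<bar>x t\<bar>) + ext_norm (\<lambda>t. \<phi> \<bar>y t\<bar>))"
    if [measurable]: "x \<in> borel_measurable M" "y \<in> borel_measurable M"
      and ab: "\<alpha> \<ge> 0" "\<beta> \<ge> 0" "\<alpha> + \<beta> = 1" for x y and \<alpha> \<beta> :: real
  proof -
    have pt: "\<phi> \<bar>\<alpha> * u + \<beta> * v\<bar> \<le> \<phi> \<bar>u\<bar> + \<phi> \<bar>v\<bar>" for u v :: real
    proof -
      have "\<bar>\<alpha> * u + \<beta> * v\<bar> \<le> \<alpha> * \<bar>u\<bar> + \<beta> * \<bar>v\<bar>"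
        using ab abs_triangle_ineq[of "\<alpha> * u" "\<beta> * v"] by (simp add: abs_mult)
      also have "\<dots> \<le> max \<bar>u\<bar> \<bar>v\<bar>" using ab by (intro convex_bound_le) auto
      finally have "\<phi> \<bar>\<alpha> * u + \<beta> * v\<bar> \<le> \<phi> (max \<bar>u\<bar> \<bar>v\<bar>)"
        by (intro mono_onD[OF mono]) auto
      also have "\<dots> \<le> \<phi> \<bar>u\<bar> + \<phi> \<bar>v\<bar>" by (simp add: max_def)
      finally show ?thesis .
    qed
    have "ext_norm (\<lambda>t. \<phi> \<bar>\<alpha> * x t + \<beta> * y t\<bar>) \<le> ext_norm (\<lambda>t. \<phi> \<bar>x t\<bar> + \<phi> \<bar>y t\<bar>)"
      using pt by (intro ext_norm_mono orlicz_comp_ennreal_measurable[OF mono]) auto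
    also have "\<dots> \<le> ennreal C * (ext_norm (\<lambda>t. \<phi> \<bar>x t\<bar>) + ext_norm (\<lambda>t. \<phi> \<bar>y t\<bar>))"
      by (intro C(2) orlicz_comp_ennreal_measurable[OF mono]) auto
    finally show ?thesis .
  qed
  then show ?thesis using C(1) by blast
qed

end

section \<open>The modular on the space of measurable functions\<close>

lemma linear_space_L0: "linear_space (L0 M) (null_functions M)"
proof -
  have "subspace (L0 M)"
    by (rule subspaceI) (auto simp: L0_def scaleR_fun_def plus_fun_def zero_fun_def)
  moreover have "subspace (null_functions M)"
    by (rule subspaceI)
      (auto simp: null_functions_def L0_def scaleR_fun_def plus_fun_def zero_fun_def)
  ultimately show ?thesis by (auto simp: linear_space_def null_functions_def)
qed

theorem theorem4p9:
  fixes M :: "'a measure"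
    and E :: "('a \<Rightarrow> real) set"
    and nrm :: "('a \<Rightarrow> real) \<Rightarrow> real"
    and \<phi> :: "real \<Rightarrow> ennreal"
    and \<alpha> :: ereal
  assumes "complete_measure M"
    and "sigma_finite_measure M"
    and "emeasure M (space M) > 0"
    and "quasi_banach_ideal_space M E nrm"
    and "fatou_property M E nrm"
    and "orlicz_function \<phi>"
    and "is_lower_index M E \<phi> \<alpha>"
    and "\<alpha> > 0"
  shows "quasi_modular (L0 M) (null_functions M) (orlicz_modular M E nrm \<phi>)"
proof -
  interpret quasi_banach_ideal M E nrm by unfold_locales fact
  have mono: "mono_on {0..} \<phi>" and \<phi>0: "\<phi> 0 = 0" and lim: "(\<phi> \<longlongrightarrow> \<infinity>) at_top"
    using \<open>orlicz_function \<phi>\<close> by (auto simp: orlicz_function_def)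
  note meas = orlicz_comp_ennreal_measurable[OF mono]
  have growth: "\<exists>p>0. growth_axiom \<phi> p"
    using \<open>is_lower_index M E \<phi> \<alpha>\<close> \<open>\<alpha> > 0\<close> growth_axiom_all[OF mono] growth_axiom_infinity[OF mono]
      growth_axiom_zero[OF mono lim]
    unfolding is_lower_index_def by blast
  have "ext_norm (\<lambda>t. \<phi> \<bar>x t\<bar>) \<le> ext_norm (\<lambda>t. \<phi> \<bar>y t\<bar>)"
    if "x \<in> L0 M" "x - y \<in> null_functions M" for x y
    using that by (intro ext_norm_mono meas) (auto simp: L0_def null_functions_def elim: AE_mp)
  moreover have "y - x \<in> null_functions M" if "x - y \<in> null_functions M" for x y :: "'a \<Rightarrow> real"
    using subspace_neg[of "null_functions M" "x - y"] linear_space_L0[of M] that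
    by (simp add: linear_space_def)
  ultimately have "functional_on (L0 M) (null_functions M) (orlicz_modular M E nrm \<phi>)"
    unfolding functional_on_def orlicz_modular_eq_ext_norm by (blast intro: antisym)
  moreover have "orlicz_modular M E nrm \<phi> 0 = 0"
    using zero_E nrm_eq_0_iff[OF zero_E]
    by (simp add: orlicz_modular_eq_ext_norm ext_norm_def \<phi>0)
  moreover have "x \<in> null_functions M"
    if "x \<in> L0 M" "\<And>c. c > 0 \<Longrightarrow> orlicz_modular M E nrm \<phi> (c *\<^sub>R x) \<le> 1" for x
    using modular_separates[OF mono lim, of x] that
    by (auto simp: null_functions_def L0_def orlicz_modular_eq_ext_norm scaleR_fun_def)
  moreover have "mono_on {0..} (\<lambda>c. orlicz_modular M E nrm \<phi> (c *\<^sub>R x))" if "x \<in> L0 M" for x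
  proof (rule mono_onI)
    fix c d :: real assume "c \<in> {0..}" "d \<in> {0..}" "c \<le> d"
    then have "\<phi> \<bar>c * x t\<bar> \<le> \<phi> \<bar>d * x t\<bar>" for t
      by (intro mono_onD[OF mono]) (auto simp: abs_mult mult_right_mono)
    then show "orlicz_modular M E nrm \<phi> (c *\<^sub>R x) \<le> orlicz_modular M E nrm \<phi> (d *\<^sub>R x)"
      using that unfolding orlicz_modular_eq_ext_norm
      by (intro ext_norm_mono meas) (auto simp: scaleR_fun_def L0_def)
  qed
  moreover note modular_convex_combination[OF mono] growth
  ultimately show ?thesis
    unfolding quasi_modular_def growth_axiom_def L0_def[symmetric]
    by (simp add: linear_space_L0 orlicz_modular_eq_ext_norm scaleR_fun_def)
qed

end
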